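(* Any subgroup of $\Gamma=PSL(2,\mathbb Z)$ is a free product (possibly infinite) of copies of the cyclic groups $\mathbb Z$, $\mathbb Z_2$, and $\mathbb Z_3$.
   Context: $\mathbb Z_m$ is the cyclic group of order $m$. *)

theory Defs
  imports "HOL-Analysis.Determinants" "HOL-Algebra.Elementary_Groups"
begin

section \<open>The modular group\<close>

definition SL2Z :: "(int ^ 2 ^ 2) monoid" where
  "SL2Z = \<lparr>carrier = {A. det A = 1}, monoid.mult = (**), one = mat 1\<rparr>"

definition PSL2Z :: "(int ^ 2 ^ 2) set monoid" where
  "PSL2Z = SL2Z Mod {mat 1, - mat 1}"

lemma uminus_matrix_mult_left: "(- A) ** B = - (A ** B)"
  for A :: "'a::comm_ring_1 ^ 'n ^ 'm" and B :: "'a ^ 'k ^ 'n"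
  by (simp add: matrix_matrix_mult_def vec_eq_iff sum_negf)

lemma uminus_matrix_mult_right: "A ** (- B) = - (A ** B)"
  for A :: "'a::comm_ring_1 ^ 'n ^ 'm" and B :: "'a ^ 'k ^ 'n"
  by (simp add: matrix_matrix_mult_def vec_eq_iff sum_negf)

lemma det_uminus_2: "det (- A) = det A" for A :: "int ^ 2 ^ 2"
  by (simp add: det_2)

lemma group_SL2Z: "group SL2Z"
proof (rule groupI)
  fix A :: "int ^ 2 ^ 2"
  assume "A \<in> carrier SL2Z"
  then have d: "A $ 1 $ 1 * A $ 2 $ 2 - A $ 1 $ 2 * A $ 2 $ 1 = 1"
    by (simp add: SL2Z_def det_2)
  define B :: "int ^ 2 ^ 2" where
    "B = vector [vector [A $ 2 $ 2, - A $ 1 $ 2], vector [- A $ 2 $ 1, A $ 1 $ 1]]"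
  have "B ** A = mat 1"
    using d by (simp add: B_def matrix_matrix_mult_def mat_def vec_eq_iff forall_2 sum_2
        vector_2 algebra_simps)
  moreover have "det B = 1"
    using d by (simp add: B_def det_2 vector_2 algebra_simps)
  ultimately show "\<exists>B\<in>carrier SL2Z. B \<otimes>\<^bsub>SL2Z\<^esub> A = \<one>\<^bsub>SL2Z\<^esub>"
    by (auto simp: SL2Z_def)
qed (auto simp: SL2Z_def det_mul matrix_mul_assoc)

lemma normal_pm_one: "{mat 1, - mat 1} \<lhd> SL2Z"
proof -
  interpret group SL2Z by (rule group_SL2Z)
  have c: "{mat 1, - mat 1} \<subseteq> carrier SL2Z"
    by (auto simp: SL2Z_def det_uminus_2)
  have "subgroup {mat 1, - mat 1} SL2Z"
  proof (rule subgroupI)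
    show "inv\<^bsub>SL2Z\<^esub> A \<in> {mat 1, - mat 1}" if "A \<in> {mat 1, - mat 1}" for A
    proof -
      have "A ** A = mat 1"
        using that by (auto simp: uminus_matrix_mult_left uminus_matrix_mult_right)
      then have "inv\<^bsub>SL2Z\<^esub> A = A"
        using c that by (intro inv_equality) (auto simp: SL2Z_def)
      with that show ?thesis by simp
    qed
  qed (use c in \<open>auto simp: SL2Z_def uminus_matrix_mult_left uminus_matrix_mult_right\<close>)
  then show ?thesis
  proof (rule normalI, intro ballI)
    show "{mat 1, - mat 1} #>\<^bsub>SL2Z\<^esub> A = A <#\<^bsub>SL2Z\<^esub> {mat 1, - mat 1}" for A
      by (auto simp: r_coset_def l_coset_def SL2Z_def uminus_matrix_mult_left
          uminus_matrix_mult_right)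
  qed
qed

lemma group_PSL2Z: "group PSL2Z"
  unfolding PSL2Z_def by (rule normal.factorgroup_is_group[OF normal_pm_one])


section \<open>Free products\<close>

text \<open>
  The free product of a family of groups is the set of words whose letters are elements of the
  factors, each tagged with the index of its factor, modulo deleting identity letters and
  multiplying adjacent letters with the same index; the product is concatenation.
\<close>

definition fp_words :: "'i set \<Rightarrow> ('i \<Rightarrow> ('a, 'b) monoid_scheme) \<Rightarrow> ('i \<times> 'a) list set" where
  "fp_words I G = lists (SIGMA i:I. carrier (G i))"

inductive_set fp_rel :: "'i set \<Rightarrow> ('i \<Rightarrow> ('a, 'b) monoid_scheme) \<Rightarrow> (('i \<times> 'a) list \<times> ('i \<times> 'a) list) set"
  for I G where
  refl: "w \<in> fp_words I G \<Longrightarrow> (w, w) \<in> fp_rel I G"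
| sym: "(v, w) \<in> fp_rel I G \<Longrightarrow> (w, v) \<in> fp_rel I G"
| trans: "\<lbrakk>(u, v) \<in> fp_rel I G; (v, w) \<in> fp_rel I G\<rbrakk> \<Longrightarrow> (u, w) \<in> fp_rel I G"
| unit: "\<lbrakk>u \<in> fp_words I G; v \<in> fp_words I G; i \<in> I\<rbrakk>
    \<Longrightarrow> (u @ [(i, \<one>\<^bsub>G i\<^esub>)] @ v, u @ v) \<in> fp_rel I G"
| mult: "\<lbrakk>u \<in> fp_words I G; v \<in> fp_words I G; i \<in> I; x \<in> carrier (G i); y \<in> carrier (G i)\<rbrakk>
    \<Longrightarrow> (u @ [(i, x), (i, y)] @ v, u @ [(i, x \<otimes>\<^bsub>G i\<^esub> y)] @ v) \<in> fp_rel I G"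

definition free_product :: "'i set \<Rightarrow> ('i \<Rightarrow> ('a, 'b) monoid_scheme) \<Rightarrow> ('i \<times> 'a) list set monoid" where
  "free_product I G =
     \<lparr>carrier = fp_words I G // fp_rel I G,
      monoid.mult = (\<lambda>X Y. \<Union>u\<in>X. \<Union>v\<in>Y. fp_rel I G `` {u @ v}),
      one = fp_rel I G `` {[]}\<rparr>"

lemma fp_words_simps [simp]:
  "[] \<in> fp_words I G"
  "p # w \<in> fp_words I G \<longleftrightarrow> fst p \<in> I \<and> snd p \<in> carrier (G (fst p)) \<and> w \<in> fp_words I G"
  "v @ w \<in> fp_words I G \<longleftrightarrow> v \<in> fp_words I G \<and> w \<in> fp_words I G"
  by (cases p; auto simp: fp_words_def)+

lemma fp_rel_words:
  assumes "\<And>i. i \<in> I \<Longrightarrow> group (G i)" and "(v, w) \<in> fp_rel I G"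
  shows "v \<in> fp_words I G \<and> w \<in> fp_words I G"
  using assms(2)
  by induction (auto intro: monoid.m_closed monoid.one_closed group.is_monoid assms(1))

lemma fp_rel_append_left:
  assumes "(v, w) \<in> fp_rel I G" and "u \<in> fp_words I G"
  shows "(u @ v, u @ w) \<in> fp_rel I G"
  using assms
proof (induction)
  case (unit a b i)
  then show ?case using fp_rel.unit[of "u @ a" I G b i] by simp
next
  case (mult a b i x y)
  then show ?case using fp_rel.mult[of "u @ a" I G b i x y] by simp
qed (auto intro: fp_rel.refl fp_rel.sym fp_rel.trans)

lemma fp_rel_append_right:
  assumes "(v, w) \<in> fp_rel I G" and "u \<in> fp_words I G"
  shows "(v @ u, w @ u) \<in> fp_rel I G"
  using assms
proof (induction)
  case (unit a b i)
  then show ?case using fp_rel.unit[of a I G "b @ u" i] by simp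
next
  case (mult a b i x y)
  then show ?case using fp_rel.mult[of a I G "b @ u" i x y] by simp
qed (auto intro: fp_rel.refl fp_rel.sym fp_rel.trans)

context
  fixes I :: "'i set" and G :: "'i \<Rightarrow> ('a, 'b) monoid_scheme"
  assumes groups: "\<And>i. i \<in> I \<Longrightarrow> group (G i)"
begin

lemma equiv_fp_rel: "equiv (fp_words I G) (fp_rel I G)"
proof (rule equivI)
  show "fp_rel I G \<subseteq> fp_words I G \<times> fp_words I G"
    by (auto dest: fp_rel_words[rotated] intro: groups)
qed (auto intro!: refl_onI symI transI intro: fp_rel.intros)

lemma fp_class_mult:
  assumes "v \<in> fp_words I G" and "w \<in> fp_words I G"
  shows "fp_rel I G `` {v} \<otimes>\<^bsub>free_product I G\<^esub> fp_rel I G `` {w} = fp_rel I G `` {v @ w}"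
proof -
  have "congruent2 (fp_rel I G) (fp_rel I G) (\<lambda>v w. fp_rel I G `` {v @ w})"
  proof (rule congruent2I')
    fix v v' w w'
    assume *: "(v, v') \<in> fp_rel I G" "(w, w') \<in> fp_rel I G"
    then have "(v @ w, v' @ w') \<in> fp_rel I G"
      by (meson fp_rel.trans fp_rel_append_left fp_rel_append_right equiv_fp_rel
          equiv_class_eq_iff)
    then show "fp_rel I G `` {v @ w} = fp_rel I G `` {v' @ w'}"
      by (rule equiv_class_eq[OF equiv_fp_rel])
  qed
  then show ?thesis
    using UN_equiv_class2[OF equiv_fp_rel equiv_fp_rel] assms
    by (simp add: free_product_def)
qed

lemma group_free_product: "group (free_product I G)"
proof -
  let ?c = "\<lambda>w. fp_rel I G `` {w}"
  have carr: "carrier (free_product I G) = ?c ` fp_words I G"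
    by (auto simp: free_product_def quotient_def)
  have one: "\<one>\<^bsub>free_product I G\<^esub> = ?c []"
    by (simp add: free_product_def)
  have inverse: "\<exists>v\<in>fp_words I G. (v @ w, []) \<in> fp_rel I G" if "w \<in> fp_words I G" for w
    using that
  proof (induction w)
    case Nil
    show ?case by (rule bexI[of _ "[]"]) (auto intro: fp_rel.refl)
  next
    case (Cons p w)
    obtain i x where p: "p = (i, x)" by (cases p)
    with Cons obtain v where v: "v \<in> fp_words I G" "(v @ w, []) \<in> fp_rel I G"
      and ix: "i \<in> I" "x \<in> carrier (G i)" and w: "w \<in> fp_words I G" by auto
    interpret Gi: group "G i" using groups ix(1) .
    have "(v @ [(i, inv\<^bsub>G i\<^esub> x), (i, x)] @ w, v @ [(i, inv\<^bsub>G i\<^esub> x \<otimes>\<^bsub>G i\<^esub> x)] @ w) \<in> fp_rel I G"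
      using v w ix by (intro fp_rel.mult) auto
    moreover have "(v @ [(i, \<one>\<^bsub>G i\<^esub>)] @ w, v @ w) \<in> fp_rel I G"
      using v w ix by (intro fp_rel.unit) auto
    ultimately have "((v @ [(i, inv\<^bsub>G i\<^esub> x)]) @ p # w, []) \<in> fp_rel I G"
      using v(2) ix p by (auto intro: fp_rel.trans)
    then show ?case
      using v(1) ix by (intro bexI[of _ "v @ [(i, inv\<^bsub>G i\<^esub> x)]"]) auto
  qed
  show ?thesis
  proof (rule groupI)
    fix X assume "X \<in> carrier (free_product I G)"
    then obtain w where w: "w \<in> fp_words I G" "X = ?c w" using carr by auto
    with inverse obtain v where v: "v \<in> fp_words I G" "(v @ w, []) \<in> fp_rel I G" by blast
    have "?c v \<otimes>\<^bsub>free_product I G\<^esub> X = \<one>\<^bsub>free_product I G\<^esub>"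
      using v w equiv_class_eq[OF equiv_fp_rel v(2)] by (simp add: fp_class_mult one)
    with v(1) show "\<exists>Y\<in>carrier (free_product I G). Y \<otimes>\<^bsub>free_product I G\<^esub> X = \<one>\<^bsub>free_product I G\<^esub>"
      using carr by auto
  qed (auto simp: carr one fp_class_mult)
qed

text \<open>The universal property: the free product is the coproduct in the category of groups.\<close>

theorem free_product_universal:
  fixes K (structure)
  assumes "group K" and hom: "\<And>i. i \<in> I \<Longrightarrow> h i \<in> hom (G i) K"
  shows "\<exists>f\<in>hom (free_product I G) K.
           (\<forall>i\<in>I. \<forall>x\<in>carrier (G i). f (fp_rel I G `` {[(i, x)]}) = h i x) \<and>
           (\<forall>g\<in>hom (free_product I G) K.
              (\<forall>i\<in>I. \<forall>x\<in>carrier (G i). g (fp_rel I G `` {[(i, x)]}) = h i x) \<longrightarrow>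
              (\<forall>X\<in>carrier (free_product I G). g X = f X))"
proof -
  interpret K: group K by fact
  interpret F: group "free_product I G" by (rule group_free_product)
  let ?c = "\<lambda>w. fp_rel I G `` {w}"
  have carr: "carrier (free_product I G) = ?c ` fp_words I G"
    by (auto simp: free_product_def quotient_def)
  define ev where "ev w = foldr (\<lambda>(i, x) k. h i x \<otimes> k) w \<one>" for w
  have ev_simps [simp]: "ev [] = \<one>" "ev ((i, x) # w) = h i x \<otimes> ev w" for i x w
    by (simp_all add: ev_def)
  have h_closed [simp]: "h i x \<in> carrier K" if "i \<in> I" "x \<in> carrier (G i)" for i x
    using hom[OF that(1)] that(2) by (rule hom_in_carrier)
  have ev_closed [simp]: "ev w \<in> carrier K" if "w \<in> fp_words I G" for w
    using that by (induction w) auto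
  have ev_append: "ev (v @ w) = ev v \<otimes> ev w" if "v \<in> fp_words I G" "w \<in> fp_words I G" for v w
    using that by (induction v) (auto simp: K.m_assoc)
  have ev_rel: "ev v = ev w" if "(v, w) \<in> fp_rel I G" for v w
    using that
  proof induction
    case (unit u v i)
    interpret group_hom "G i" K "h i"
      using unit groups hom assms(1) by (simp add: group_hom_def group_hom_axioms_def)
    show ?case using unit by (simp add: ev_append)
  next
    case (mult u v i x y)
    interpret group_hom "G i" K "h i"
      using mult groups hom assms(1) by (simp add: group_hom_def group_hom_axioms_def)
    show ?case using mult by (simp add: ev_append K.m_assoc)
  qed auto
  define f where "f X = ev (SOME w. w \<in> X)" for X
  have f_class: "f (?c w) = ev w" if "w \<in> fp_words I G" for w
  proof -
    have "(SOME v. v \<in> ?c w) \<in> ?c w"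
      by (rule someI[of _ w]) (simp add: that fp_rel.refl)
    then show ?thesis using ev_rel unfolding f_def by fastforce
  qed
  have f_hom: "f \<in> hom (free_product I G) K"
    by (rule homI) (auto simp: carr f_class fp_class_mult ev_append)
  have unique: "g X = f X"
    if g: "g \<in> hom (free_product I G) K"
      and gh: "\<forall>i\<in>I. \<forall>x\<in>carrier (G i). g (?c [(i, x)]) = h i x"
      and X: "X \<in> carrier (free_product I G)" for g X
  proof -
    interpret g: group_hom "free_product I G" K g
      using g by unfold_locales
    have "g (?c w) = ev w" if "w \<in> fp_words I G" for w
      using that
    proof (induction w)
      case Nil
      have "?c [] = \<one>\<^bsub>free_product I G\<^esub>" by (simp add: free_product_def)
      then show ?case by simp
    next
      case (Cons p w)
      obtain i x where p: "p = (i, x)" by (cases p)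
      have "?c (p # w) = ?c [(i, x)] \<otimes>\<^bsub>free_product I G\<^esub> ?c w"
        using Cons.prems p by (simp add: fp_class_mult)
      then show ?case using Cons gh p carr by auto
    qed
    with X show ?thesis by (auto simp: carr f_class)
  qed
  have "\<forall>i\<in>I. \<forall>x\<in>carrier (G i). f (?c [(i, x)]) = h i x"
    by (auto simp: f_class)
  with f_hom unique show ?thesis by (intro bexI[of _ f]) auto
qed

end

end

theory Submission
  imports Defs "HOL-Library.Countable_Set"
begin

text \<open>
  The maps $s: z \mapsto -1/z$ and $u: z \mapsto (z-1)/z$ generate $PSL(2,\mathbb Z)$ and satisfy no
  relations beyond the consequences of $s^2 = u^3 = 1$. For generation one runs the Euclidean
  algorithm on the first column of a matrix (\<open>word_mat_generates\<close>). For the relations, a word without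
  factors \<open>SS\<close> and \<open>UUU\<close> is, up to its two ends, a product of blocks \<open>US\<close> and \<open>UUS\<close>, and up to sign
  these blocks are the elementary matrices with nonnegative entries, whose products have growing
  entries (\<open>word_eq_Nil_of_word_mat\<close>).

  Let $H$ be a subgroup. The group acts on the left cosets $gH$, and $s$ and $u$ act by permutations
  $\sigma$ and $\tau$ with $\sigma^2 = \tau^3 = 1$. Take the orbits of $\tau$ as the vertices of a graph and the
  orbits of $\sigma$ of size two as its edges. A breadth-first search yields a spanning tree, and with it a
  path from the base point to every coset. Following the path to $x$, then one letter, then the path back
  gives the Schreier generators of $H$. They are trivial along the tree and along the $\tau$-orbits of
  size three. What is left is a generator of order two for every fixed point of
  $\sigma$, one of order three for every fixed point of $\tau$, and one of infinite order for every edge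
  outside the tree. Let $F$ be the free product of the corresponding cyclic groups.

  To see that $F$ is isomorphic to $H$ no normal form in $F$ is needed. Label each step
  $x \to \sigma x$, $x \to \tau x$ by its generator in $F$. The labels respect $s^2 = u^3 = 1$
  (\<open>weight_SS\<close>, \<open>weight_UUU\<close>), so by the presentation the product of the labels along a word depends on the
  group element only. On words that close up at the base point this is a homomorphism $\varphi: H \to F$.
  In the other direction the universal property of $F$ gives $\psi: F \to H$, which sends each generator to
  its Schreier generator. The product $\varphi \circ \psi$ fixes the generators of $F$
  because labels are trivial along the tree (\<open>cocycle_path\<close>), and $\psi \circ \varphi$ is the
  identity because a product of Schreier generators telescopes (\<open>subgroup_iso_free_product\<close>).
\<close>

section \<open>Words in two letters and their actions\<close>

datatype letter = S | U

instance letter :: countable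
  by countable_datatype

text \<open>
  The congruence on words whose classes form the group $\langle S, U \mid S^2, U^3\rangle$. Keeping
  it syntactic lets one and the same presentation act on every set that carries two maps with
  these orders, whatever its type.
\<close>

inductive word_eq :: "letter list \<Rightarrow> letter list \<Rightarrow> bool" (infix \<open>\<simeq>\<close> 50) where
  refl: "w \<simeq> w"
| sym: "v \<simeq> w \<Longrightarrow> w \<simeq> v"
| trans: "u \<simeq> v \<Longrightarrow> v \<simeq> w \<Longrightarrow> u \<simeq> w"
| SS: "v @ [S, S] @ w \<simeq> v @ w"
| UUU: "v @ [U, U, U] @ w \<simeq> v @ w"

lemma word_eq_append_left: "v \<simeq> w \<Longrightarrow> u @ v \<simeq> u @ w"
proof (induction rule: word_eq.induct)
  case (SS v w)
  then show ?case using word_eq.SS[of "u @ v" w] by simp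
next
  case (UUU v w)
  then show ?case using word_eq.UUU[of "u @ v" w] by simp
qed (auto intro: word_eq.refl word_eq.sym word_eq.trans)

lemma word_eq_append_right: "v \<simeq> w \<Longrightarrow> v @ u \<simeq> w @ u"
proof (induction rule: word_eq.induct)
  case (SS v w)
  then show ?case using word_eq.SS[of v "w @ u"] by simp
next
  case (UUU v w)
  then show ?case using word_eq.UUU[of v "w @ u"] by simp
qed (auto intro: word_eq.refl word_eq.sym word_eq.trans)

lemma word_eq_left_inverse: "\<exists>v. v @ w \<simeq> []"
proof (induction w)
  case Nil
  show ?case by (rule exI[of _ "[]"]) (simp add: word_eq.refl)
next
  case (Cons l w)
  then obtain v where v: "v @ w \<simeq> []" by blast
  show ?case
  proof (cases l)
    case S
    then show ?thesis using word_eq.trans[OF word_eq.SS[of v w] v]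
      by (intro exI[of _ "v @ [S]"]) simp
  next
    case U
    then show ?thesis using word_eq.trans[OF word_eq.UUU[of v w] v]
      by (intro exI[of _ "v @ [U, U]"]) simp
  qed
qed

definition blocks :: "bool list \<Rightarrow> letter list" where
  "blocks es = concat (map (\<lambda>e. if e then [U, S] else [U, U, S]) es)"

lemma blocks_simps [simp]:
  "blocks [] = []"
  "blocks (True # es) = U # S # blocks es"
  "blocks (False # es) = U # U # S # blocks es"
  by (simp_all add: blocks_def)

text \<open>
  Reduction letter by letter from the left: a new \<open>S\<close> toggles the initial \<open>S\<close>; a new \<open>U\<close> turns
  an initial \<open>S\<close> into a block \<open>US\<close>, a block \<open>US\<close> into \<open>UUS\<close>, and a block \<open>UUS\<close> into \<open>S\<close> because
  \<open>UUU\<close> cancels. Without blocks it only counts the final letters \<open>U\<close> modulo three.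
\<close>

lemma word_eq_normal_form:
  "\<exists>a es b. a \<in> {[], [S]} \<and> b \<in> {[], [U], [U, U]} \<and> w \<simeq> a @ blocks es @ b"
proof (induction w)
  case Nil
  have "[] \<simeq> [] @ blocks [] @ []" by (simp add: word_eq.refl)
  then show ?case by blast
next
  case (Cons l w)
  then obtain a es b where ab: "a \<in> {[], [S]}" "b \<in> {[], [U], [U, U]}"
    and w: "w \<simeq> a @ blocks es @ b" by blast
  have lw: "l # w \<simeq> l # a @ blocks es @ b"
    using word_eq_append_left[OF w, of "[l]"] by simp
  have *: ?case
    if "a' \<in> {[], [S]}" "b' \<in> {[], [U], [U, U]}" "l # a @ blocks es @ b \<simeq> a' @ blocks es' @ b'"
    for a' es' b'
    using that word_eq.trans[OF lw] by blast
  note SS = word_eq.SS[of "[]", simplified] and UUU = word_eq.UUU[of "[]", simplified]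
  show ?case
  proof (cases l)
    case S
    show ?thesis
    proof (cases "a = []")
      case True
      show ?thesis by (rule *[of "[S]" b es]) (use ab S True in \<open>auto intro: word_eq.refl\<close>)
    next
      case False
      then have "a = [S]" using ab by simp
      then show ?thesis using SS[of "blocks es @ b"] S ab by (intro *[of "[]" b es]) auto
    qed
  next
    case U
    show ?thesis
    proof (cases "a = []")
      case False
      then have "a = [S]" using ab by simp
      then show ?thesis
        using U ab by (intro *[of "[]" b "True # es"]) (auto intro: word_eq.refl)
    next
      case a: True
      show ?thesis
      proof (cases es)
        case Nil
        consider "b = []" | "b = [U]" | "b = [U, U]" using ab by blast
        then show ?thesis
        proof cases
          case 1
          show ?thesis by (rule *[of "[]" "[U]" "[]"]) (use a Nil U 1 in \<open>auto intro: word_eq.refl\<close>)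
        next
          case 2
          show ?thesis by (rule *[of "[]" "[U, U]" "[]"]) (use a Nil U 2 in \<open>auto intro: word_eq.refl\<close>)
        next
          case 3
          show ?thesis by (rule *[of "[]" "[]" "[]"]) (use a Nil U 3 UUU[of "[]"] in auto)
        qed
      next
        case (Cons e es')
        show ?thesis
        proof (cases e)
          case True
          show ?thesis
            by (rule *[of "[]" b "False # es'"]) (use ab U a Cons True in \<open>auto intro: word_eq.refl\<close>)
        next
          case False
          show ?thesis
            by (rule *[of "[S]" b es']) (use ab U a Cons False UUU[of "S # blocks es' @ b"] in auto)
        qed
      qed
    qed
  qed
qed

fun word_act :: "('x \<Rightarrow> 'x) \<Rightarrow> ('x \<Rightarrow> 'x) \<Rightarrow> letter list \<Rightarrow> 'x \<Rightarrow> 'x" where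
  "word_act \<sigma> \<tau> [] x = x"
| "word_act \<sigma> \<tau> (S # w) x = \<sigma> (word_act \<sigma> \<tau> w x)"
| "word_act \<sigma> \<tau> (U # w) x = \<tau> (word_act \<sigma> \<tau> w x)"

lemma word_act_append:
  "word_act \<sigma> \<tau> (v @ w) x = word_act \<sigma> \<tau> v (word_act \<sigma> \<tau> w x)"
  by (induction \<sigma> \<tau> v x rule: word_act.induct) auto

locale modular_action =
  fixes X :: "'x set" and \<sigma> \<tau> :: "'x \<Rightarrow> 'x"
  assumes \<sigma>_closed [simp]: "x \<in> X \<Longrightarrow> \<sigma> x \<in> X"
    and \<tau>_closed [simp]: "x \<in> X \<Longrightarrow> \<tau> x \<in> X"
    and \<sigma>\<sigma> [simp]: "x \<in> X \<Longrightarrow> \<sigma> (\<sigma> x) = x"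
    and \<tau>\<tau>\<tau> [simp]: "x \<in> X \<Longrightarrow> \<tau> (\<tau> (\<tau> x)) = x"
begin

abbreviation act :: "letter list \<Rightarrow> 'x \<Rightarrow> 'x" where
  "act \<equiv> word_act \<sigma> \<tau>"

lemma act_closed [simp]: "x \<in> X \<Longrightarrow> act w x \<in> X"
proof (induction w)
  case (Cons l w)
  then show ?case by (cases l) auto
qed auto

lemma act_word_eq: "v \<simeq> w \<Longrightarrow> x \<in> X \<Longrightarrow> act v x = act w x"
  by (induction rule: word_eq.induct) (auto simp: word_act_append)

end


section \<open>The modular group is presented by an involution and an element of order three\<close>

text \<open>
  The presentation $\langle s, u \mid s^2, u^3\rangle$ is all that the study of subgroups needs to know
  about the modular group.
\<close>

locale modular_presentation = group \<Gamma> for \<Gamma> (structure) +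
  fixes s u :: 'a
  assumes s_closed [simp]: "s \<in> carrier \<Gamma>" and u_closed [simp]: "u \<in> carrier \<Gamma>"
    and ss: "s \<otimes> s = \<one>" and uuu: "u \<otimes> (u \<otimes> u) = \<one>"
    and generated: "g \<in> carrier \<Gamma> \<Longrightarrow> \<exists>w. word_act ((\<otimes>) s) ((\<otimes>) u) w \<one> = g"
    and presented: "word_act ((\<otimes>) s) ((\<otimes>) u) w \<one> = \<one> \<Longrightarrow> w \<simeq> []"

definition mat2 :: "int \<Rightarrow> int \<Rightarrow> int \<Rightarrow> int \<Rightarrow> int ^ 2 ^ 2" where
  "mat2 a b c d = vector [vector [a, b], vector [c, d]]"

lemma mat2_nth [simp]:
  "mat2 a b c d $ 1 $ 1 = a" "mat2 a b c d $ 1 $ 2 = b"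
  "mat2 a b c d $ 2 $ 1 = c" "mat2 a b c d $ 2 $ 2 = d"
  by (simp_all add: mat2_def vector_2)

lemma mat2_eq_iff [simp]:
  "mat2 a b c d = mat2 a' b' c' d' \<longleftrightarrow> a = a' \<and> b = b' \<and> c = c' \<and> d = d'"
  by (auto simp: vec_eq_iff forall_2)

lemma mat2_cases: obtains a b c d where "A = mat2 a b c d"
  by (rule that[of "A $ 1 $ 1" "A $ 1 $ 2" "A $ 2 $ 1" "A $ 2 $ 2"]) (simp add: vec_eq_iff forall_2)

lemma mat2_mult [simp]:
  "mat2 a b c d ** mat2 a' b' c' d' =
     mat2 (a * a' + b * c') (a * b' + b * d') (c * a' + d * c') (c * b' + d * d')"
  by (simp add: vec_eq_iff forall_2 matrix_matrix_mult_def sum_2)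

lemma mat2_uminus [simp]: "- mat2 a b c d = mat2 (- a) (- b) (- c) (- d)"
  by (simp add: vec_eq_iff forall_2)

lemma mat2_one: "mat 1 = mat2 1 0 0 1"
  by (simp add: vec_eq_iff forall_2 mat_def)

lemma det_mat2 [simp]: "det (mat2 a b c d) = a * d - b * c"
  by (simp add: det_2)

definition matS :: "int ^ 2 ^ 2" where "matS = mat2 0 (- 1) 1 0"
definition matU :: "int ^ 2 ^ 2" where "matU = mat2 1 (- 1) 1 0"

text \<open>
  In $SL(2,\mathbb Z)$ itself both \<open>matS ** matS\<close> and \<open>matU ** matU ** matU\<close> are \<open>- mat 1\<close>, so the
  matrix of a word is an invariant of its class up to sign only.
\<close>

abbreviation word_mat :: "letter list \<Rightarrow> int ^ 2 ^ 2" where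
  "word_mat w \<equiv> word_act ((**) matS) ((**) matU) w (mat 1)"

lemma word_mat_append: "word_mat (v @ w) = word_mat v ** word_mat w"
proof (induction v)
  case (Cons l v)
  then show ?case by (cases l) (auto simp: matrix_mul_assoc)
qed simp

lemma word_mat_word_eq: "v \<simeq> w \<Longrightarrow> word_mat v \<in> {word_mat w, - word_mat w}"
proof (induction rule: word_eq.induct)
  case (SS v w)
  have "word_mat [S, S] = - mat 1" by (simp add: matS_def mat2_one)
  then have "word_mat (v @ [S, S] @ w) = - word_mat (v @ w)"
    by (simp only: word_mat_append uminus_matrix_mult_left uminus_matrix_mult_right) simp
  then show ?case by simp
next
  case (UUU v w)
  have "word_mat [U, U, U] = - mat 1" by (simp add: matU_def mat2_one)
  then have "word_mat (v @ [U, U, U] @ w) = - word_mat (v @ w)"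
    by (simp only: word_mat_append uminus_matrix_mult_left uminus_matrix_mult_right) simp
  then show ?case by simp
qed auto

text \<open>
  Up to sign a block \<open>US\<close> is the elementary matrix that adds the second row to the first, and a block
  \<open>UUS\<close> adds the first row to the second. As no row of an invertible matrix vanishes, the sum of
  the entries, which is two for the identity, grows with each block.
\<close>

lemma word_mat_blocks:
  "\<exists>p q r t. word_mat (blocks es) \<in> {mat2 p q r t, - mat2 p q r t} \<and> p * t - q * r = 1 \<and>
     0 \<le> p \<and> 0 \<le> q \<and> 0 \<le> r \<and> 0 \<le> t \<and> (es \<noteq> [] \<longrightarrow> 3 \<le> p + q + r + t)"
proof (induction es)
  case Nil
  show ?case by (intro exI[of _ 1] exI[of _ 0]) (simp add: mat2_one)
next
  case (Cons e es)
  then obtain p q r t where M: "word_mat (blocks es) \<in> {mat2 p q r t, - mat2 p q r t}"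
    and det: "p * t - q * r = 1" and nonneg: "0 \<le> p" "0 \<le> q" "0 \<le> r" "0 \<le> t" by blast
  have "1 \<le> p + q"
  proof (rule ccontr)
    assume "\<not> 1 \<le> p + q"
    with nonneg have "p = 0" "q = 0" by auto
    with det show False by simp
  qed
  moreover have "1 \<le> r + t"
  proof (rule ccontr)
    assume "\<not> 1 \<le> r + t"
    with nonneg have "r = 0" "t = 0" by auto
    with det show False by simp
  qed
  ultimately have sum: "3 \<le> (p + r) + (q + t) + r + t" "3 \<le> p + q + (p + r) + (q + t)" by auto
  show ?case
  proof (cases e)
    case True
    have "word_mat (blocks (e # es)) \<in> {mat2 (p + r) (q + t) r t, - mat2 (p + r) (q + t) r t}"
      using M by (auto simp: True matS_def matU_def)
    then show ?thesis using det nonneg sum(1)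
      by (intro exI[of _ "p + r"] exI[of _ "q + t"] exI[of _ r] exI[of _ t])
        (simp add: algebra_simps)
  next
    case False
    have "word_mat (blocks (e # es)) \<in> {mat2 p q (p + r) (q + t), - mat2 p q (p + r) (q + t)}"
      using M by (auto simp: False matS_def matU_def)
    then show ?thesis using det nonneg sum(2)
      by (intro exI[of _ p] exI[of _ q] exI[of _ "p + r"] exI[of _ "q + t"])
        (simp add: algebra_simps)
  qed
qed

text \<open>
  The word reduces to $a\,M\,b$ with $M$ a product of blocks. If $a$ or $b$ is not empty, then
  comparing entries of $a\,M\,b = \pm 1$ forces entries of both signs, or a zero row, in the matrix of
  $M$, which has determinant one and entries of one sign. So only $M$ is left, and its entries sum to
  more than two as soon as it has a block.
\<close>

lemma word_eq_Nil_of_word_mat: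
  assumes "word_mat w \<in> {mat 1, - mat 1}"
  shows "w \<simeq> []"
proof -
  obtain a es b where a: "a \<in> {[], [S]}" and b: "b \<in> {[], [U], [U, U]}"
    and w: "w \<simeq> a @ blocks es @ b"
    using word_eq_normal_form[of w] by (elim exE conjE)
  obtain p q r t where M: "word_mat (blocks es) \<in> {mat2 p q r t, - mat2 p q r t}"
    and nonneg: "0 \<le> p" "0 \<le> q" "0 \<le> r" "0 \<le> t" and sum: "es \<noteq> [] \<Longrightarrow> 3 \<le> p + q + r + t"
    using word_mat_blocks[of es] by (elim exE conjE) simp
  obtain \<delta> where \<delta>: "word_mat (a @ blocks es @ b) = mat2 \<delta> 0 0 \<delta>" "\<delta> = 1 \<or> \<delta> = - 1"
  proof -
    have "word_mat (a @ blocks es @ b) \<in> {mat 1, - mat 1}"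
      using word_mat_word_eq[OF word_eq.sym[OF w]] assms by auto
    then show ?thesis using that by (auto simp: mat2_one)
  qed
  have prod: "word_mat a ** word_mat (blocks es) ** word_mat b = mat2 \<delta> 0 0 \<delta>"
    using \<delta>(1) by (simp add: word_mat_append matrix_mul_assoc)
  have "a = [] \<and> b = [] \<and> es = []"
    using a b M prod \<delta>(2) nonneg sum
    by (cases "es = []"; auto simp: mat2_one matS_def matU_def)
  with w show ?thesis by simp
qed

text \<open>
  The Euclidean algorithm on the first column $(a, c)$: the words \<open>US\<close>, \<open>SUU\<close>, \<open>UUS\<close>, \<open>SU\<close> act up
  to sign as the elementary row operations and their inverses, and one of them decreases
  $|a| + |c|$ as long as both entries are nonzero. After a possible application of \<open>S\<close> the matrix is
  triangular, hence up to sign a power of an elementary matrix.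
\<close>

lemma word_mat_generates:
  assumes "det A = 1"
  shows "\<exists>w. word_mat w \<in> {A, - A}"
proof -
  define R where "R A \<longleftrightarrow> (\<exists>w. word_mat w \<in> {A, - A})" for A
  have word: "R (word_mat w)" for w unfolding R_def by (rule exI[of _ w]) simp
  have neg: "R (- A) \<longleftrightarrow> R A" for A
    unfolding R_def by auto
  have left: "R (word_mat v ** A)" if "R A" for v A
  proof -
    from that obtain w where "word_mat w \<in> {A, - A}" unfolding R_def by (rule exE)
    then have "word_mat (v @ w) \<in> {word_mat v ** A, - (word_mat v ** A)}"
      by (auto simp: word_mat_append uminus_matrix_mult_right)
    then show ?thesis unfolding R_def by (rule exI)
  qed
  have step: "R (mat2 a b c d)" if "R (mat2 a' b' c' d')" "word_mat v ** mat2 a' b' c' d' \<in> {mat2 a b c d, - mat2 a b c d}"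
    for v a b c d a' b' c' d'
    using left[OF that(1), of v] that(2) by (auto simp: neg simp del: mat2_uminus)
  note defs = mat2_one matS_def matU_def
  have S: "R (mat2 a b c d)" if "R (mat2 (- c) (- d) a b)" for a b c d
    by (rule step[OF that, of "[S]"]) (simp add: defs)
  have T: "R (mat2 a b c d)" if "R (mat2 (a - c) (b - d) c d)" for a b c d
    by (rule step[OF that, of "[U, S]"]) (simp add: defs)
  have T': "R (mat2 a b c d)" if "R (mat2 (a + c) (b + d) c d)" for a b c d
    by (rule step[OF that, of "[S, U, U]"]) (simp add: defs)
  have L: "R (mat2 a b c d)" if "R (mat2 a b (c - a) (d - b))" for a b c d
    by (rule step[OF that, of "[U, U, S]"]) (simp add: defs)
  have L': "R (mat2 a b c d)" if "R (mat2 a b (c + a) (d + b))" for a b c d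
    by (rule step[OF that, of "[S, U]"]) (simp add: defs)
  have shear: "R (mat2 1 b 0 1)" for b
  proof (induction b rule: int_induct[where k = 0])
    case base
    show ?case using word[of "[]"] by (simp add: mat2_one)
  next
    case (step1 b)
    then show ?case by - (rule T, simp)
  next
    case (step2 b)
    then show ?case by - (rule T', simp)
  qed
  have upper: "R (mat2 a b 0 d)" if ad: "a * d = 1" for a b d
  proof -
    consider "a = 1" "d = 1" | "a = - 1" "d = - 1" using ad unfolding zmult_eq_1_iff by metis
    then show ?thesis
    proof cases
      case 1
      then show ?thesis by (simp only: shear)
    next
      case 2
      have "R (- mat2 1 (- b) 0 1)" by (simp only: neg shear)
      with 2 show ?thesis by (simp only: mat2_uminus minus_minus minus_zero)
    qed
  qed
  have "a * d - b * c = 1 \<Longrightarrow> R (mat2 a b c d)" for a b c d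
  proof (induction "nat (\<bar>a\<bar> + \<bar>c\<bar>)" arbitrary: a b c d rule: less_induct)
    case less
    consider "c = 0" | "a = 0" | "a \<noteq> 0" "c \<noteq> 0" by blast
    then show ?case
    proof cases
      case 1
      then show ?thesis using upper less.prems by simp
    next
      case 2
      then show ?thesis using less.prems by - (rule S, simp add: upper algebra_simps)
    next
      case 3
      then consider "\<bar>a - c\<bar> < \<bar>a\<bar>" | "\<bar>a + c\<bar> < \<bar>a\<bar>" | "\<bar>c - a\<bar> < \<bar>c\<bar>" | "\<bar>c + a\<bar> < \<bar>c\<bar>"
        by linarith
      then show ?thesis
      proof cases
        case 1
        then have "R (mat2 (a - c) (b - d) c d)"
          using less.prems by (intro less.hyps) (auto simp: algebra_simps)
        then show ?thesis by (rule T)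
      next
        case 2
        then have "R (mat2 (a + c) (b + d) c d)"
          using less.prems by (intro less.hyps) (auto simp: algebra_simps)
        then show ?thesis by (rule T')
      next
        case 3
        then have "R (mat2 a b (c - a) (d - b))"
          using less.prems by (intro less.hyps) (auto simp: algebra_simps)
        then show ?thesis by (rule L)
      next
        case 4
        then have "R (mat2 a b (c + a) (d + b))"
          using less.prems by (intro less.hyps) (auto simp: algebra_simps)
        then show ?thesis by (rule L')
      qed
    qed
  qed
  moreover obtain a b c d where "A = mat2 a b c d" by (rule mat2_cases)
  ultimately show ?thesis using assms unfolding R_def by fastforce
qed

definition pm :: "int ^ 2 ^ 2 \<Rightarrow> (int ^ 2 ^ 2) set" where
  "pm A = {A, - A}"

lemma pm_eq_iff: "pm A = pm B \<longleftrightarrow> A \<in> {B, - B}"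
  by (auto simp: pm_def doubleton_eq_iff)

lemma pm_coset: "{mat 1, - mat 1} #>\<^bsub>SL2Z\<^esub> A = pm A"
  by (auto simp: pm_def r_coset_def SL2Z_def uminus_matrix_mult_left)

lemma carrier_PSL2Z: "carrier PSL2Z = pm ` {A. det A = 1}"
  by (auto simp: PSL2Z_def FactGroup_def RCOSETS_def pm_coset) (auto simp: SL2Z_def)

lemma mult_PSL2Z: "pm A \<otimes>\<^bsub>PSL2Z\<^esub> pm B = pm (A ** B)"
  by (auto simp: PSL2Z_def FactGroup_def set_mult_def SL2Z_def pm_def
      uminus_matrix_mult_left uminus_matrix_mult_right)

lemma one_PSL2Z: "\<one>\<^bsub>PSL2Z\<^esub> = pm (mat 1)"
  by (simp add: PSL2Z_def FactGroup_def pm_def)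

lemma word_act_PSL2Z:
  "word_act ((\<otimes>\<^bsub>PSL2Z\<^esub>) (pm matS)) ((\<otimes>\<^bsub>PSL2Z\<^esub>) (pm matU)) w \<one>\<^bsub>PSL2Z\<^esub> = pm (word_mat w)"
proof (induction w)
  case (Cons l w)
  then show ?case by (cases l) (auto simp: mult_PSL2Z)
qed (simp add: one_PSL2Z)

lemma modular_presentation_PSL2Z: "modular_presentation PSL2Z (pm matS) (pm matU)"
proof -
  interpret group PSL2Z by (rule group_PSL2Z)
  show ?thesis
  proof
    fix g assume "g \<in> carrier PSL2Z"
    then obtain A where "g = pm A" "det A = 1" by (auto simp: carrier_PSL2Z)
    then show "\<exists>w. word_act ((\<otimes>\<^bsub>PSL2Z\<^esub>) (pm matS)) ((\<otimes>\<^bsub>PSL2Z\<^esub>) (pm matU)) w \<one>\<^bsub>PSL2Z\<^esub> = g"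
      using word_mat_generates[of A] by (auto simp: word_act_PSL2Z pm_eq_iff)
  next
    fix w
    assume "word_act ((\<otimes>\<^bsub>PSL2Z\<^esub>) (pm matS)) ((\<otimes>\<^bsub>PSL2Z\<^esub>) (pm matU)) w \<one>\<^bsub>PSL2Z\<^esub> = \<one>\<^bsub>PSL2Z\<^esub>"
    then have "pm (word_mat w) = pm (mat 1)"
      by (metis word_act_PSL2Z one_PSL2Z)
    then show "w \<simeq> []"
      by (intro word_eq_Nil_of_word_mat) (simp add: pm_eq_iff)
  qed (auto simp: carrier_PSL2Z mult_PSL2Z one_PSL2Z pm_eq_iff mat2_one matS_def matU_def)
qed

section \<open>Spanning trees and Schreier generators\<close>

text \<open>
  A connected action with a base point; later the points are the cosets of a subgroup and the base
  point is the subgroup itself.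
\<close>

locale schreier_graph = modular_action X \<sigma> \<tau> for X :: "'x set" and \<sigma> \<tau> +
  fixes x0 :: 'x
  assumes base [simp]: "x0 \<in> X"
    and connected: "x \<in> X \<Longrightarrow> \<exists>w. act w x0 = x"
begin

definition orb :: "'x \<Rightarrow> 'x set" where
  "orb x = {x, \<tau> x, \<tau> (\<tau> x)}"

lemma orb_\<tau>: "x \<in> X \<Longrightarrow> orb (\<tau> x) = orb x"
  by (auto simp: orb_def)

lemma orb_subset: "x \<in> X \<Longrightarrow> y \<in> orb x \<Longrightarrow> y \<in> X"
  by (auto simp: orb_def)

lemma orb_sym: "x \<in> X \<Longrightarrow> y \<in> orb x \<Longrightarrow> x \<in> orb y"
  by (auto simp: orb_def)

text \<open>
  Breadth-first search on the graph whose vertices are the orbits of \<open>\<tau>\<close> and whose edges are given by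
  \<open>\<sigma>\<close>. Distances count applications of \<open>\<sigma>\<close> only, so a whole orbit of \<open>\<tau>\<close> is reached at once. This
  is what makes the generators along an orbit of size three trivial without a further choice.
\<close>

primrec level :: "nat \<Rightarrow> 'x set" where
  "level 0 = orb x0"
| "level (Suc n) = {x \<in> X. \<exists>y\<in>orb x. \<sigma> y \<in> level n}"

definition depth :: "'x \<Rightarrow> nat" where
  "depth x = (LEAST n. x \<in> level n)"

lemma \<tau>_level: "x \<in> level n \<Longrightarrow> \<tau> x \<in> level n"
  by (cases n) (auto simp: orb_\<tau>, auto simp: orb_def)

lemma ex_level:
  assumes "x \<in> X"
  shows "\<exists>n. x \<in> level n"
proof -
  have "\<exists>n. act w x0 \<in> level n" for w
  proof (induction w)
    case Nil
    have "act [] x0 \<in> level 0" by (simp add: orb_def)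
    then show ?case ..
  next
    case (Cons l w)
    then obtain n where n: "act w x0 \<in> level n" ..
    show ?case
    proof (cases l)
      case S
      have "act (l # w) x0 \<in> level (Suc n)" using n S by (auto simp: orb_def)
      then show ?thesis ..
    next
      case U
      have "act (l # w) x0 \<in> level n" using n U by (auto intro: \<tau>_level)
      then show ?thesis ..
    qed
  qed
  with connected[OF assms] show ?thesis by metis
qed

lemma level_depth: "x \<in> X \<Longrightarrow> x \<in> level (depth x)"
  unfolding depth_def using ex_level by (rule LeastI_ex)

lemma depth_le: "x \<in> level n \<Longrightarrow> depth x \<le> n"
  unfolding depth_def by (rule Least_le)

lemma depth_\<tau>:
  assumes "x \<in> X"
  shows "depth (\<tau> x) = depth x"
proof -
  have "depth (\<tau> y) \<le> depth y" if "y \<in> X" for y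
    using that by (intro depth_le \<tau>_level level_depth)
  \<comment> \<open>Three steps along the orbit return to the point, so no step can decrease the depth.\<close>
  from this[of x] this[of "\<tau> x"] this[of "\<tau> (\<tau> x)"] show ?thesis using assms by simp
qed

lemma depth_orb: "x \<in> X \<Longrightarrow> y \<in> orb x \<Longrightarrow> depth y = depth x"
  by (auto simp: orb_def depth_\<tau>)

lemma depth_base: "depth x0 = 0"
  using depth_le[of x0 0] by (simp add: orb_def)

lemma ex_descent:
  assumes "x \<in> X" "depth x \<noteq> 0"
  shows "\<exists>y. y \<in> orb x \<and> depth x = Suc (depth (\<sigma> y))"
proof -
  obtain n where n: "depth x = Suc n" using assms(2) not0_implies_Suc by blast
  with level_depth[OF assms(1)] obtain y where y: "y \<in> orb x" "\<sigma> y \<in> level n" by auto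
  have "y \<in> X" using orb_subset y(1) assms(1) by blast
  then have "x \<in> level (Suc (depth (\<sigma> y)))"
    using y(1) assms(1) level_depth[of "\<sigma> y"] by auto
  then have "depth x \<le> Suc (depth (\<sigma> y))" by (rule depth_le)
  with depth_le[OF y(2)] n y(1) show ?thesis by auto
qed

text \<open>
  The point at which the spanning tree enters an orbit of \<open>\<tau>\<close>: one application of \<open>\<sigma>\<close> leads from it to an
  orbit one level closer to the base point. It depends on the orbit only.
\<close>

definition anchor :: "'x \<Rightarrow> 'x" where
  "anchor x = (if depth x = 0 then x0 else SOME y. y \<in> orb x \<and> depth x = Suc (depth (\<sigma> y)))"

lemma anchor_orb: "x \<in> X \<Longrightarrow> anchor x \<in> orb x"
  and anchor_descends: "x \<in> X \<Longrightarrow> depth x \<noteq> 0 \<Longrightarrow> depth x = Suc (depth (\<sigma> (anchor x)))"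
proof -
  assume x: "x \<in> X"
  have *: "anchor x \<in> orb x \<and> depth x = Suc (depth (\<sigma> (anchor x)))" if "depth x \<noteq> 0"
    using someI_ex[OF ex_descent[OF x that]] that by (simp add: anchor_def)
  show "anchor x \<in> orb x"
  proof (cases "depth x = 0")
    case True
    then show ?thesis using level_depth[OF x] orb_sym[of x0 x] by (simp add: anchor_def)
  qed (use * in blast)
  show "depth x = Suc (depth (\<sigma> (anchor x)))" if "depth x \<noteq> 0"
    using * that by blast
qed

lemma anchor_closed [simp]: "x \<in> X \<Longrightarrow> anchor x \<in> X"
  using anchor_orb orb_subset by blast

lemma anchor_\<tau>: "x \<in> X \<Longrightarrow> anchor (\<tau> x) = anchor x"
  by (simp add: anchor_def depth_\<tau> orb_\<tau>)

lemma depth_anchor: "x \<in> X \<Longrightarrow> depth (anchor x) = depth x"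
  using anchor_orb depth_orb by blast

lemma anchor_anchor: "x \<in> X \<Longrightarrow> anchor (anchor x) = anchor x"
  using anchor_orb[of x] by (auto simp: orb_def anchor_\<tau>)

lemma anchor_base: "anchor x0 = x0"
  by (simp add: anchor_def depth_base)

text \<open>
  The power of \<open>U\<close> that leads from the anchor of an orbit to the given point of the orbit.
\<close>

definition offset :: "'x \<Rightarrow> letter list" where
  "offset x = (if anchor x = x then [] else if \<tau> (anchor x) = x then [U] else [U, U])"

text \<open>
  The number bounds the recursion; with the depth of the point it is exactly the number of edges of the
  tree that the path follows.
\<close>

primrec path_upto :: "nat \<Rightarrow> 'x \<Rightarrow> letter list" where
  "path_upto 0 x = offset x"
| "path_upto (Suc n) x = offset x @ S # path_upto n (\<sigma> (anchor x))"

definition path :: "'x \<Rightarrow> letter list" where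
  "path x = path_upto (depth x) x"

lemma path_root: "depth x = 0 \<Longrightarrow> path x = offset x"
  by (simp add: path_def)

lemma path_step:
  assumes "x \<in> X" "depth x \<noteq> 0"
  shows "path x = offset x @ S # path (\<sigma> (anchor x))"
proof -
  obtain n where "depth x = Suc n" using assms(2) not0_implies_Suc by blast
  then show ?thesis using anchor_descends[OF assms] by (simp add: path_def)
qed

lemma path_base: "path x0 = []"
  by (simp add: path_root depth_base offset_def anchor_base)

lemma offset_cases:
  assumes "x \<in> X"
  obtains "anchor x = x" "offset x = []"
  | "anchor x \<noteq> x" "\<tau> (anchor x) = x" "offset x = [U]"
  | "anchor x \<noteq> x" "\<tau> (anchor x) \<noteq> x" "\<tau> (\<tau> (anchor x)) = x" "offset x = [U, U]"
proof -
  have "x \<in> orb (anchor x)" using anchor_orb orb_sym assms by blast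
  then have "anchor x = x \<or> \<tau> (anchor x) = x \<or> \<tau> (\<tau> (anchor x)) = x" by (auto simp: orb_def)
  then show thesis using that unfolding offset_def by metis
qed

lemma act_offset: "x \<in> X \<Longrightarrow> act (offset x) (anchor x) = x"
  by (erule offset_cases) auto

lemma path_induct [consumes 1, case_names root step]:
  assumes "x \<in> X"
    and root: "\<And>x. x \<in> X \<Longrightarrow> depth x = 0 \<Longrightarrow> P x"
    and step: "\<And>x. x \<in> X \<Longrightarrow> depth x \<noteq> 0 \<Longrightarrow> P (\<sigma> (anchor x)) \<Longrightarrow> P x"
  shows "P x"
  using assms(1)
proof (induction "depth x" arbitrary: x rule: less_induct)
  case less
  show ?case
  proof (cases "depth x = 0")
    case False
    show ?thesis
      by (rule step) (use less anchor_descends[OF less.prems False] False in auto)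
  qed (rule root[OF less.prems])
qed

lemma act_path: "x \<in> X \<Longrightarrow> act (path x) x0 = x"
proof (induction x rule: path_induct)
  case (root x)
  then show ?case using act_offset[of x] by (simp add: path_root anchor_def)
next
  case (step x)
  then show ?case using act_offset[of x] by (simp add: path_step word_act_append)
qed

text \<open>
  Within an orbit of size three the paths differ by the letters \<open>U\<close> of their offsets only, up to
  one cancellation of \<open>UUU\<close> when \<open>\<tau>\<close> returns to the anchor.
\<close>

lemma path_\<tau>:
  assumes "x \<in> X" "\<tau> x \<noteq> x"
  shows "path (\<tau> x) \<simeq> U # path x"
proof -
  have "offset (\<tau> x) \<simeq> U # offset x"
    using assms(1)
  proof (cases rule: offset_cases)
    case 1
    then have "offset (\<tau> x) = [U]" using assms by (simp add: offset_def anchor_\<tau>)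
    with 1 show ?thesis by (simp add: word_eq.refl)
  next
    case 2
    then have "\<tau> x \<noteq> anchor x"
      using assms(2) \<tau>\<tau>\<tau>[of "anchor x"] assms(1) by (metis anchor_closed)
    then have "offset (\<tau> x) = [U, U]"
      using assms 2 by (simp add: offset_def anchor_\<tau>)
    with 2 show ?thesis by (simp add: word_eq.refl)
  next
    case 3
    then have "\<tau> x = anchor x" using assms(1) by (metis \<tau>\<tau>\<tau> anchor_closed)
    then have "offset (\<tau> x) = []"
      using assms(1) by (simp add: offset_def anchor_\<tau> anchor_anchor)
    with 3 show ?thesis using word_eq.sym[OF word_eq.UUU[of "[]" "[]"]] by simp
  qed
  then show ?thesis
    using assms(1) word_eq_append_right
    by (cases "depth x = 0") (fastforce simp: path_root path_step depth_\<tau> anchor_\<tau>)+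
qed

text \<open>
  In the tree an orbit of \<open>\<tau>\<close> off level zero is joined to its parent at its anchor. Either end of an
  edge may be that anchor.
\<close>

definition tree_edge :: "'x \<Rightarrow> bool" where
  "tree_edge x \<longleftrightarrow> (\<exists>y \<in> {x, \<sigma> x}. depth y \<noteq> 0 \<and> anchor y = y)"

lemma tree_edge_\<sigma>: "x \<in> X \<Longrightarrow> tree_edge (\<sigma> x) \<longleftrightarrow> tree_edge x"
  by (auto simp: tree_edge_def)

lemma path_tree_edge:
  assumes "x \<in> X" "tree_edge x"
  shows "path (\<sigma> x) \<simeq> S # path x"
proof -
  have down: "path y = S # path (\<sigma> y)" if "y \<in> X" "depth y \<noteq> 0" "anchor y = y" for y
    using path_step[OF that(1,2)] that(3) by (simp add: offset_def)
  from assms(2) consider "depth x \<noteq> 0" "anchor x = x" | "depth (\<sigma> x) \<noteq> 0" "anchor (\<sigma> x) = \<sigma> x"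
    by (auto simp: tree_edge_def)
  then show ?thesis
  proof cases
    case 1
    then show ?thesis
      using down[of x] assms(1) word_eq.sym[OF word_eq.SS[of "[]" "path (\<sigma> x)"]] by simp
  next
    case 2
    then show ?thesis using down[of "\<sigma> x"] assms(1) by (simp add: word_eq.refl)
  qed
qed

text \<open>
  Words form a monoid only, so the inverse of a path is some word that cancels it.
\<close>

definition return_path :: "'x \<Rightarrow> letter list" where
  "return_path x = (SOME v. v @ path x \<simeq> [])"

lemma return_path_path: "return_path x @ path x \<simeq> []"
  unfolding return_path_def by (rule someI_ex) (rule word_eq_left_inverse)

lemma act_return_path: "x \<in> X \<Longrightarrow> act (return_path x) x = x0"
  using act_word_eq[OF return_path_path base, of x] by (simp add: word_act_append act_path)

section \<open>The free product attached to the graph\<close>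

lemma countable_X: "countable X"
proof -
  have "X \<subseteq> range (\<lambda>w. act w x0)"
  proof
    fix x assume "x \<in> X"
    then obtain w where "x = act w x0" using connected by metis
    then show "x \<in> range (\<lambda>w. act w x0)" by simp
  qed
  then show ?thesis by (rule countable_subset) (rule countable_image, rule countableI_type)
qed

abbreviation code :: "'x \<Rightarrow> nat" where
  "code \<equiv> to_nat_on X"

lemma code_eq_iff: "x \<in> X \<Longrightarrow> y \<in> X \<Longrightarrow> code x = code y \<longleftrightarrow> x = y"
  by (simp add: countable_X)

text \<open>
  The factors are indexed by natural numbers: the even number \<open>2 * code x\<close> stands for the edge of \<open>\<sigma>\<close>
  that starts at \<open>x\<close>, the odd number after it for the orbit of \<open>\<tau>\<close> that consists of \<open>x\<close> alone.
\<close>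

definition point :: "nat \<Rightarrow> 'x" where
  "point i = from_nat_into X (i div 2)"

lemma point_code [simp]: "x \<in> X \<Longrightarrow> point (2 * code x) = x" "x \<in> X \<Longrightarrow> point (Suc (2 * code x)) = x"
  by (simp_all add: point_def countable_X)

text \<open>
  Of the two orientations of an edge outside the tree the one with increasing codes is kept.
\<close>

definition indices :: "nat set" where
  "indices = {2 * code x |x. x \<in> X \<and> (\<sigma> x = x \<or> \<not> tree_edge x \<and> code x < code (\<sigma> x))} \<union>
     {Suc (2 * code x) |x. x \<in> X \<and> \<tau> x = x}"

text \<open>
  The order zero stands for an infinite cyclic group, in accordance with \<open>integer_mod_group 0\<close>, which
  allows a uniform treatment of all factors.
\<close>

definition factor_order :: "nat \<Rightarrow> nat" where
  "factor_order i = (if odd i then 3 else if \<sigma> (point i) = point i then 2 else 0)"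

definition factor :: "nat \<Rightarrow> int monoid" where
  "factor i = integer_mod_group (factor_order i)"

lemma factor_in: "factor i \<in> {integer_group, integer_mod_group 2, integer_mod_group 3}"
  by (auto simp: factor_def factor_order_def integer_mod_group_def)

lemma group_factor [simp]: "group (factor i)"
  by (simp add: factor_def)

lemma one_in_factor [simp]: "1 \<in> carrier (factor i)"
  by (simp add: factor_def factor_order_def)

abbreviation F :: "(nat \<times> int) list set monoid" where
  "F \<equiv> free_product indices factor"

sublocale F: group F
  by (rule group_free_product) simp

abbreviation cls :: "(nat \<times> int) list \<Rightarrow> (nat \<times> int) list set" where
  "cls w \<equiv> fp_rel indices factor `` {w}"

lemma cls_hom:
  assumes "i \<in> indices"
  shows "group_hom (factor i) F (\<lambda>n. cls [(i, n)])"
proof -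
  have "(\<lambda>n. cls [(i, n)]) \<in> hom (factor i) F"
  proof (rule homI)
    fix m n assume mn: "m \<in> carrier (factor i)" "n \<in> carrier (factor i)"
    have "([(i, m), (i, n)], [(i, m \<otimes>\<^bsub>factor i\<^esub> n)]) \<in> fp_rel indices factor"
      using fp_rel.mult[of "[]" indices factor "[]" i m n] mn assms by simp
    then have "cls [(i, m), (i, n)] = cls [(i, m \<otimes>\<^bsub>factor i\<^esub> n)]"
      by (rule equiv_class_eq[OF equiv_fp_rel, rotated]) simp
    then show "cls [(i, m \<otimes>\<^bsub>factor i\<^esub> n)] = cls [(i, m)] \<otimes>\<^bsub>F\<^esub> cls [(i, n)]"
      using mn assms by (simp add: fp_class_mult)
  qed (use assms in \<open>auto simp: free_product_def quotient_def\<close>)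
  then show ?thesis by (simp add: group_hom_def group_hom_axioms_def F.is_group)
qed

definition gen :: "nat \<Rightarrow> (nat \<times> int) list set" where
  "gen i = cls [(i, 1)]"

lemma gen_closed [simp]: "i \<in> indices \<Longrightarrow> gen i \<in> carrier F"
  unfolding gen_def using group_hom.hom_closed[OF cls_hom] by simp

lemma cls_eq_gen_pow:
  assumes "i \<in> indices" "n \<in> carrier (factor i)"
  shows "cls [(i, n)] = gen i [^]\<^bsub>F\<^esub> n"
proof -
  interpret group_hom "factor i" F "\<lambda>n. cls [(i, n)]" using assms(1) by (rule cls_hom)
  have "1 [^]\<^bsub>factor i\<^esub> n = n"
    using assms(2) by (auto simp: factor_def int_pow_integer_mod_group carrier_integer_mod_group split: if_splits)
  then show ?thesis using hom_int_pow[of 1 n] by (simp add: gen_def)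
qed

lemma gen_pow_order:
  assumes "i \<in> indices"
  shows "gen i [^]\<^bsub>F\<^esub> factor_order i = \<one>\<^bsub>F\<^esub>"
proof -
  interpret group_hom "factor i" F "\<lambda>n. cls [(i, n)]" using assms(1) by (rule cls_hom)
  have "1 [^]\<^bsub>factor i\<^esub> factor_order i = \<one>\<^bsub>factor i\<^esub>" by (simp add: factor_def)
  then show ?thesis using hom_nat_pow[of 1 "factor_order i"] by (simp add: gen_def)
qed

text \<open>
  The universal property of \<open>F\<close> in terms of generators: each factor is cyclic, so a homomorphism out of
  it amounts to an element of the target that is killed by the order of the factor.
\<close>

lemma hom_from_F:
  fixes K (structure)
  assumes "group K" and v: "\<And>i. i \<in> indices \<Longrightarrow> v i \<in> carrier K"
    and order: "\<And>i. i \<in> indices \<Longrightarrow> v i [^] factor_order i = \<one>"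
  shows "\<exists>\<psi>\<in>hom F K. \<forall>i\<in>indices. \<psi> (gen i) = v i"
proof -
  interpret K: group K by fact
  have "(\<lambda>n. v i [^] n) \<in> hom (factor i) K" if i: "i \<in> indices" for i
  proof (rule homI)
    let ?m = "factor_order i"
    fix k n :: int
    have "v i [^] (k + n) = v i [^] ((k + n) mod int ?m + int ?m * ((k + n) div int ?m))"
      by simp
    also have "\<dots> = v i [^] ((k + n) mod int ?m) \<otimes> (v i [^] int ?m) [^] ((k + n) div int ?m)"
      using v[OF i] by (simp only: K.int_pow_mult K.int_pow_pow)
    also have "v i [^] int ?m = \<one>"
      using order[OF i] by (simp add: int_pow_int)
    finally show "v i [^] (k \<otimes>\<^bsub>factor i\<^esub> n) = v i [^] k \<otimes> v i [^] n"
      using v[OF i] by (simp add: factor_def K.int_pow_mult)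
  qed (use v[OF i] in simp)
  then have "\<exists>\<psi>\<in>hom F K. (\<forall>i\<in>indices. \<forall>n\<in>carrier (factor i). \<psi> (cls [(i, n)]) = v i [^] n) \<and>
      (\<forall>g\<in>hom F K. (\<forall>i\<in>indices. \<forall>n\<in>carrier (factor i). g (cls [(i, n)]) = v i [^] n) \<longrightarrow>
         (\<forall>f\<in>carrier F. g f = \<psi> f))"
    by (intro free_product_universal K.is_group) simp_all
  then obtain \<psi> where "\<psi> \<in> hom F K"
      "\<forall>i\<in>indices. \<forall>n\<in>carrier (factor i). \<psi> (cls [(i, n)]) = v i [^] n"
    by (elim bexE conjE)
  then show ?thesis using v by (intro bexI[of _ \<psi>]) (simp_all add: gen_def)
qed

lemma hom_eq_on_gen:
  fixes K (structure)
  assumes "group K" and g: "g \<in> hom F K" and g': "g' \<in> hom F K"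
    and eq: "\<And>i. i \<in> indices \<Longrightarrow> g (gen i) = g' (gen i)" and f: "f \<in> carrier F"
  shows "g f = g' f"
proof -
  interpret K: group K by fact
  interpret g: group_hom F K g using g by unfold_locales
  interpret g': group_hom F K g' using g' by unfold_locales
  have cls_eq: "g' (cls [(i, n)]) = g (cls [(i, n)])" if "i \<in> indices" "n \<in> carrier (factor i)" for i n
    using that eq by (simp add: cls_eq_gen_pow g.hom_int_pow g'.hom_int_pow)
  have "(\<lambda>n. g (cls [(i, n)])) \<in> hom (factor i) K" if "i \<in> indices" for i
    using hom_compose[OF group_hom.homh[OF cls_hom[OF that]] g] by (simp add: comp_def)
  then have "\<exists>e\<in>hom F K. (\<forall>i\<in>indices. \<forall>n\<in>carrier (factor i). e (cls [(i, n)]) = g (cls [(i, n)])) \<and>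
      (\<forall>h\<in>hom F K. (\<forall>i\<in>indices. \<forall>n\<in>carrier (factor i). h (cls [(i, n)]) = g (cls [(i, n)])) \<longrightarrow>
         (\<forall>f\<in>carrier F. h f = e f))"
    by (intro free_product_universal K.is_group) simp_all
  then obtain e where e: "\<forall>h\<in>hom F K. (\<forall>i\<in>indices. \<forall>n\<in>carrier (factor i).
      h (cls [(i, n)]) = g (cls [(i, n)])) \<longrightarrow> (\<forall>f\<in>carrier F. h f = e f)"
    by (elim bexE conjE)
  have "g f = e f" using e[rule_format, OF g] f by simp
  moreover have "g' f = e f" using e[rule_format, OF g'] f cls_eq by simp
  ultimately show ?thesis by simp
qed

lemma \<sigma>_index: "x \<in> X \<Longrightarrow> 2 * code x \<in> indices \<longleftrightarrow> \<sigma> x = x \<or> \<not> tree_edge x \<and> code x < code (\<sigma> x)"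
  by (auto simp: indices_def code_eq_iff) presburger+

lemma \<tau>_index: "x \<in> X \<Longrightarrow> Suc (2 * code x) \<in> indices \<longleftrightarrow> \<tau> x = x"
  by (auto simp: indices_def code_eq_iff) presburger+

text \<open>
  The label in \<open>F\<close> of the step that applies a letter at a point. These are the values that the
  Schreier generators must have under an isomorphism onto \<open>F\<close>.
\<close>

fun weight :: "letter \<Rightarrow> 'x \<Rightarrow> (nat \<times> int) list set" where
  "weight S x = (if \<sigma> x = x then gen (2 * code x) else if tree_edge x then \<one>\<^bsub>F\<^esub>
     else if code x < code (\<sigma> x) then gen (2 * code x) else inv\<^bsub>F\<^esub> gen (2 * code (\<sigma> x)))"
| "weight U x = (if \<tau> x = x then gen (Suc (2 * code x)) else \<one>\<^bsub>F\<^esub>)"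

text \<open>
  Of two opposite steps along an edge outside the tree exactly one runs in the direction of increasing
  codes. Its label is the generator, and the other label is the inverse.
\<close>

lemma weight_S_cases:
  assumes "x \<in> X"
  obtains (fixed) "\<sigma> x = x" "2 * code x \<in> indices" "weight S x = gen (2 * code x)"
  | (tree) "\<sigma> x \<noteq> x" "tree_edge x" "weight S x = \<one>\<^bsub>F\<^esub>"
  | (forward) "\<sigma> x \<noteq> x" "\<not> tree_edge x" "2 * code x \<in> indices"
      "weight S x = gen (2 * code x)" "weight S (\<sigma> x) = inv\<^bsub>F\<^esub> gen (2 * code x)"
  | (backward) "\<sigma> x \<noteq> x" "\<not> tree_edge x" "2 * code (\<sigma> x) \<in> indices"
      "weight S x = inv\<^bsub>F\<^esub> gen (2 * code (\<sigma> x))" "weight S (\<sigma> x) = gen (2 * code (\<sigma> x))"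
proof -
  have "\<sigma> x \<noteq> x \<Longrightarrow> code x < code (\<sigma> x) \<or> code (\<sigma> x) < code x"
    using code_eq_iff[of x "\<sigma> x"] assms by auto
  then show thesis
    using that assms by (auto simp: \<sigma>_index tree_edge_\<sigma>)
qed

lemma weight_closed [simp]: "x \<in> X \<Longrightarrow> weight l x \<in> carrier F"
proof (cases l)
  case S
  then show "x \<in> X \<Longrightarrow> weight l x \<in> carrier F"
    by (simp only:, elim weight_S_cases) (simp_all del: weight.simps)
qed (simp add: \<tau>_index)

lemma weight_SS:
  assumes "x \<in> X"
  shows "weight S (\<sigma> x) \<otimes>\<^bsub>F\<^esub> weight S x = \<one>\<^bsub>F\<^esub>"
  using assms
proof (cases rule: weight_S_cases)
  case fixed
  have "gen (2 * code x) [^]\<^bsub>F\<^esub> (2::nat) = \<one>\<^bsub>F\<^esub>"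
    using gen_pow_order[OF fixed(2)] fixed(1) assms by (simp add: factor_order_def)
  with fixed show ?thesis by (simp add: numeral_2_eq_2)
next
  case tree
  then show ?thesis using assms tree_edge_\<sigma>[of x] by auto
qed simp_all

lemma weight_UUU:
  assumes "x \<in> X"
  shows "weight U (\<tau> (\<tau> x)) \<otimes>\<^bsub>F\<^esub> (weight U (\<tau> x) \<otimes>\<^bsub>F\<^esub> weight U x) = \<one>\<^bsub>F\<^esub>"
proof (cases "\<tau> x = x")
  case True
  then have i: "Suc (2 * code x) \<in> indices" using assms by (simp add: \<tau>_index)
  have "gen (Suc (2 * code x)) [^]\<^bsub>F\<^esub> (3::nat) = \<one>\<^bsub>F\<^esub>"
    using gen_pow_order[OF i] by (simp add: factor_order_def)
  with i True show ?thesis by (simp add: numeral_3_eq_3 F.m_assoc)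
next
  case False
  then have "\<tau> (\<tau> x) \<noteq> \<tau> x" "x \<noteq> \<tau> (\<tau> x)" using assms \<tau>\<tau>\<tau>[of x] by metis+
  with False show ?thesis using assms by simp
qed

text \<open>
  The covering of the graph with fibre \<open>F\<close> that the labels define. As the relations hold for it, the
  label of a word is an invariant of its class.
\<close>

definition lift :: "letter \<Rightarrow> ('x \<Rightarrow> 'x) \<Rightarrow> 'x \<times> (nat \<times> int) list set \<Rightarrow> 'x \<times> (nat \<times> int) list set" where
  "lift l \<rho> p = (\<rho> (fst p), weight l (fst p) \<otimes>\<^bsub>F\<^esub> snd p)"

lemma lift_action: "modular_action (X \<times> carrier F) (lift S \<sigma>) (lift U \<tau>)"
proof
  fix p assume p: "p \<in> X \<times> carrier F"
  then obtain x f where [simp]: "p = (x, f)" "x \<in> X" "f \<in> carrier F" by auto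
  show "lift S \<sigma> p \<in> X \<times> carrier F" "lift U \<tau> p \<in> X \<times> carrier F"
    by (simp_all add: lift_def del: weight.simps)
  show "lift S \<sigma> (lift S \<sigma> p) = p"
    by (simp add: lift_def weight_SS F.m_assoc[symmetric] del: weight.simps)
  have "weight U (\<tau> (\<tau> x)) \<otimes>\<^bsub>F\<^esub> (weight U (\<tau> x) \<otimes>\<^bsub>F\<^esub> (weight U x \<otimes>\<^bsub>F\<^esub> f)) =
      weight U (\<tau> (\<tau> x)) \<otimes>\<^bsub>F\<^esub> (weight U (\<tau> x) \<otimes>\<^bsub>F\<^esub> weight U x) \<otimes>\<^bsub>F\<^esub> f"
    by (simp add: F.m_assoc del: weight.simps)
  then show "lift U \<tau> (lift U \<tau> (lift U \<tau> p)) = p"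
    by (simp add: lift_def weight_UUU del: weight.simps)
qed

definition cocycle :: "letter list \<Rightarrow> 'x \<Rightarrow> (nat \<times> int) list set" where
  "cocycle w x = snd (word_act (lift S \<sigma>) (lift U \<tau>) w (x, \<one>\<^bsub>F\<^esub>))"

lemma cocycle_word_eq: "v \<simeq> w \<Longrightarrow> x \<in> X \<Longrightarrow> cocycle v x = cocycle w x"
  unfolding cocycle_def using modular_action.act_word_eq[OF lift_action] by fastforce

lemma fst_lift: "fst (word_act (lift S \<sigma>) (lift U \<tau>) w p) = act w (fst p)"
proof (induction w)
  case (Cons l w)
  then show ?case by (cases l) (auto simp: lift_def)
qed simp

lemma cocycle_Nil [simp]: "cocycle [] x = \<one>\<^bsub>F\<^esub>"
  by (simp add: cocycle_def)

lemma cocycle_Cons: "cocycle (l # w) x = weight l (act w x) \<otimes>\<^bsub>F\<^esub> cocycle w x"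
  by (cases l) (simp_all add: cocycle_def lift_def fst_lift del: weight.simps)

lemma cocycle_closed [simp]: "x \<in> X \<Longrightarrow> cocycle w x \<in> carrier F"
  by (induction w) (simp_all add: cocycle_Cons del: weight.simps)

lemma cocycle_append:
  "x \<in> X \<Longrightarrow> cocycle (v @ w) x = cocycle v (act w x) \<otimes>\<^bsub>F\<^esub> cocycle w x"
  by (induction v) (simp_all add: cocycle_Cons word_act_append F.m_assoc del: weight.simps)

lemma cocycle_offset:
  assumes "x \<in> X"
  shows "cocycle (offset x) (anchor x) = \<one>\<^bsub>F\<^esub>"
  using assms
proof (cases rule: offset_cases)
  case 2
  then show ?thesis by (simp add: cocycle_Cons)
next
  case 3
  then have "\<tau> (anchor x) \<noteq> anchor x" by metis
  with 3 show ?thesis by (simp add: cocycle_Cons)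
qed simp

text \<open>
  The path meets only steps within an orbit of size three and edges of the tree, and both carry the
  trivial label.
\<close>

lemma cocycle_path: "x \<in> X \<Longrightarrow> cocycle (path x) x0 = \<one>\<^bsub>F\<^esub>"
proof (induction x rule: path_induct)
  case (root x)
  then show ?case using cocycle_offset[of x] by (simp add: path_root anchor_def)
next
  case (step x)
  define a where "a = anchor x"
  have a: "a \<in> X" "anchor a = a" and depth_a: "depth a = depth x"
    using step(1) by (simp_all add: a_def anchor_anchor depth_anchor)
  moreover have "depth a \<noteq> depth (\<sigma> a)"
    using anchor_descends[OF step(1,2)] unfolding a_def[symmetric] depth_a by linarith
  ultimately have "depth a \<noteq> 0" "\<sigma> (\<sigma> a) \<noteq> \<sigma> a"
    using step(2) by auto
  with a have "weight S (\<sigma> a) = \<one>\<^bsub>F\<^esub>" by (simp add: tree_edge_def)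
  then show ?case
    using step a(1) cocycle_offset[of x] unfolding a_def
    by (simp add: path_step cocycle_append cocycle_Cons act_path del: weight.simps)
qed

lemma cocycle_return_path:
  assumes "x \<in> X"
  shows "cocycle (return_path x) x = \<one>\<^bsub>F\<^esub>"
  using cocycle_word_eq[OF return_path_path base, of x] assms
  by (simp add: cocycle_append act_path cocycle_path)

text \<open>
  The Schreier generator of a step, as a word: out to the point, along the step, and back.
\<close>

definition loop :: "letter \<Rightarrow> 'x \<Rightarrow> letter list" where
  "loop l x = return_path (act [l] x) @ l # path x"

lemma act_loop: "x \<in> X \<Longrightarrow> act (loop l x) x0 = x0"
  by (cases l) (simp_all add: loop_def word_act_append act_path act_return_path)

lemma cocycle_loop: "x \<in> X \<Longrightarrow> cocycle (loop l x) x0 = weight l x"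
  by (cases l) (simp_all add: loop_def cocycle_append cocycle_Cons act_path cocycle_path cocycle_return_path
      del: weight.simps)

definition gen_loop :: "nat \<Rightarrow> letter list" where
  "gen_loop i = loop (if even i then S else U) (point i)"

lemma indices_cases:
  assumes "i \<in> indices"
  obtains (\<sigma>_fixed) x where "x \<in> X" "i = 2 * code x" "\<sigma> x = x" "factor_order i = 2" "gen_loop i = loop S x"
  | (\<sigma>_edge) x where "x \<in> X" "i = 2 * code x" "\<sigma> x \<noteq> x" "code x < code (\<sigma> x)" "\<not> tree_edge x"
     "factor_order i = 0" "gen_loop i = loop S x"
  | (\<tau>_fixed) x where "x \<in> X" "i = Suc (2 * code x)" "\<tau> x = x" "factor_order i = 3" "gen_loop i = loop U x"
  using assms unfolding indices_def
  by (auto simp: gen_loop_def factor_order_def)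

lemma act_gen_loop: "i \<in> indices \<Longrightarrow> act (gen_loop i) x0 = x0"
  by (erule indices_cases) (simp_all add: act_loop)

lemma cocycle_gen_loop: "i \<in> indices \<Longrightarrow> cocycle (gen_loop i) x0 = gen i"
  by (erule indices_cases) (simp_all add: cocycle_loop)

end

section \<open>Subgroups are free products\<close>

context modular_presentation
begin

definition val :: "letter list \<Rightarrow> 'a" where
  "val w = word_act ((\<otimes>) s) ((\<otimes>) u) w \<one>"

lemma val_simps [simp]:
  "val [] = \<one>" "val (S # w) = s \<otimes> val w" "val (U # w) = u \<otimes> val w"
  by (simp_all add: val_def)

lemma translation_action: "modular_action (carrier \<Gamma>) ((\<otimes>) s) ((\<otimes>) u)"
proof
  fix x assume x: "x \<in> carrier \<Gamma>"
  show "s \<otimes> (s \<otimes> x) = x" using x by (simp add: m_assoc[symmetric] ss)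
  have "u \<otimes> (u \<otimes> (u \<otimes> x)) = u \<otimes> (u \<otimes> u) \<otimes> x" using x by (simp add: m_assoc)
  then show "u \<otimes> (u \<otimes> (u \<otimes> x)) = x" using x by (simp add: uuu)
qed simp_all

lemma val_closed [simp]: "val w \<in> carrier \<Gamma>"
  unfolding val_def using modular_action.act_closed[OF translation_action] by simp

lemma val_word_eq: "v \<simeq> w \<Longrightarrow> val v = val w"
  unfolding val_def using modular_action.act_word_eq[OF translation_action] by simp

lemma val_append: "val (v @ w) = val v \<otimes> val w"
proof (induction v)
  case (Cons l v)
  then show ?case by (cases l) (simp_all add: m_assoc)
qed simp

text \<open>
  The presentation speaks of words with trivial value only; appending an inverse of one of the words
  reduces the comparison of two words to that case.
\<close>

lemma val_eq_imp_word_eq: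
  assumes "val v = val w"
  shows "v \<simeq> w"
proof -
  obtain w' where w': "w' @ w \<simeq> []" using word_eq_left_inverse by blast
  have "val (w' @ w) = \<one>" using val_word_eq[OF w'] by simp
  then have "val w \<otimes> val w' = \<one>"
    by (simp add: val_append inv_comm)
  then have "val (v @ w') = \<one>" using assms by (simp add: val_append)
  then have vw: "v @ w' \<simeq> []" using presented by (simp add: val_def)
  have "v \<simeq> v @ w' @ w"
    using word_eq_append_left[OF w', of v] word_eq.sym by simp
  moreover have "v @ w' @ w \<simeq> w"
    using word_eq_append_right[OF vw, of w] by simp
  ultimately show ?thesis by (rule word_eq.trans)
qed

end

locale modular_subgroup = modular_presentation \<Gamma> s u for \<Gamma> :: "('a, 'b) monoid_scheme" (structure) and s u +
  fixes H :: "'a set"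
  assumes subgroup: "subgroup H \<Gamma>"
begin

abbreviation cosets :: "'a set set" where
  "cosets \<equiv> (\<lambda>g. g <# H) ` carrier \<Gamma>"

lemma H_subset: "H \<subseteq> carrier \<Gamma>"
  using subgroup by (rule subgroup.subset)

lemma act_coset: "g \<in> carrier \<Gamma> \<Longrightarrow> word_act (l_coset \<Gamma> s) (l_coset \<Gamma> u) w (g <# H) = (val w \<otimes> g) <# H"
proof (induction w)
  case (Cons l w)
  then show ?case by (cases l) (simp_all add: lcos_m_assoc H_subset m_assoc)
qed simp

lemma act_base: "word_act (l_coset \<Gamma> s) (l_coset \<Gamma> u) w H = val w <# H"
  using act_coset[of \<one> w] by (simp add: lcos_mult_one H_subset)

lemma coset_eq_H_iff:
  assumes "g \<in> carrier \<Gamma>"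
  shows "g <# H = H \<longleftrightarrow> g \<in> H"
proof
  have "g \<in> g <# H" using assms subgroup.one_closed[OF subgroup] by (force simp: l_coset_def)
  then show "g <# H = H \<Longrightarrow> g \<in> H" by simp
qed (rule coset_join3[OF assms subgroup])

sublocale schreier_graph cosets "l_coset \<Gamma> s" "l_coset \<Gamma> u" H
proof
  fix x assume "x \<in> cosets"
  then obtain g where g: "g \<in> carrier \<Gamma>" and x: "x = g <# H" by blast
  show "s <# x \<in> cosets" "u <# x \<in> cosets"
    using g by (auto simp: x lcos_m_assoc H_subset)
  show "s <# (s <# x) = x" "u <# (u <# (u <# x)) = x"
    using g modular_action.\<sigma>\<sigma>[OF translation_action g] modular_action.\<tau>\<tau>\<tau>[OF translation_action g]
    by (simp_all add: x lcos_m_assoc H_subset)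
  obtain w where "val w = g" using generated[OF g] by (auto simp: val_def)
  then show "\<exists>w. word_act (l_coset \<Gamma> s) (l_coset \<Gamma> u) w H = x" by (auto simp: act_base x)
next
  show "H \<in> cosets" using lcos_mult_one[OF H_subset] by (metis imageI one_closed)
qed

lemma act_base_iff: "act w H = H \<longleftrightarrow> val w \<in> H"
  by (simp add: act_base coset_eq_H_iff)

abbreviation H_group :: "('a, 'b) monoid_scheme" where
  "H_group \<equiv> \<Gamma>\<lparr>carrier := H\<rparr>"

sublocale H: group H_group
  using subgroup by (rule subgroup_imp_group)

text \<open>
  The homomorphism from the subgroup to \<open>F\<close>: the label of a word with the given value, read from the base
  point. Words with the same value are congruent, so the choice of the word is immaterial.
\<close>

definition cocycle_hom :: "'a \<Rightarrow> (nat \<times> int) list set" where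
  "cocycle_hom h = cocycle (SOME w. val w = h) H"

lemma cocycle_hom_val: "cocycle_hom (val w) = cocycle w H"
proof -
  have "val (SOME v. val v = val w) = val w" by (rule someI[where x = w]) simp
  then show ?thesis
    unfolding cocycle_hom_def by (intro cocycle_word_eq val_eq_imp_word_eq base)
qed

lemma H_eq_val:
  assumes "h \<in> H"
  obtains w where "h = val w" "act w H = H"
proof -
  obtain w where "h = val w" using generated assms H_subset by (metis subsetD val_def)
  with assms that show thesis by (simp add: act_base_iff)
qed

lemma cocycle_hom: "cocycle_hom \<in> hom H_group F"
proof (rule homI)
  fix g h assume "g \<in> carrier H_group" "h \<in> carrier H_group"
  then obtain v w where vw: "g = val v" "h = val w" and "act v H = H" "act w H = H"
    by (auto elim!: H_eq_val)
  then show "cocycle_hom (g \<otimes>\<^bsub>H_group\<^esub> h) = cocycle_hom g \<otimes>\<^bsub>F\<^esub> cocycle_hom h"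
    by (simp add: cocycle_hom_val val_append[symmetric] cocycle_append)
qed (auto elim!: H_eq_val simp: cocycle_hom_val)

abbreviation rep :: "'a set \<Rightarrow> 'a" where
  "rep x \<equiv> val (path x)"

lemma val_return_path: "val (return_path x) = inv rep x"
  using val_word_eq[OF return_path_path, of x] by (simp add: val_append inv_equality)

lemma val_loop: "val (loop l x) = inv rep (act [l] x) \<otimes> val [l] \<otimes> rep x"
  using val_append[of "[l]" "path x"]
  by (cases l) (simp_all add: loop_def val_append val_return_path m_assoc)

lemma mult_inv_cancel: "t \<in> carrier \<Gamma> \<Longrightarrow> g \<in> carrier \<Gamma> \<Longrightarrow> t \<otimes> (inv t \<otimes> g) = g"
  by (simp add: m_assoc[symmetric])

lemma conj_mult_conj: "t \<in> carrier \<Gamma> \<Longrightarrow> g \<in> carrier \<Gamma> \<Longrightarrow> g' \<in> carrier \<Gamma> \<Longrightarrow>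
   inv t \<otimes> g \<otimes> t \<otimes> (inv t \<otimes> g' \<otimes> t) = inv t \<otimes> (g \<otimes> g') \<otimes> t"
  by (simp add: m_assoc mult_inv_cancel)

lemma val_loop_in: "x \<in> cosets \<Longrightarrow> val (loop l x) \<in> H"
  using act_loop[of x l] by (simp only: act_base_iff)

lemma val_gen_loop_in: "i \<in> indices \<Longrightarrow> val (gen_loop i) \<in> H"
  using act_gen_loop act_base_iff by blast

text \<open>
  At a fixed point the Schreier generator is a conjugate of \<open>s\<close> or \<open>u\<close>.
\<close>

lemma val_gen_loop_pow:
  assumes "i \<in> indices"
  shows "val (gen_loop i) [^]\<^bsub>H_group\<^esub> factor_order i = \<one>"
proof -
  have closed [simp]: "val (gen_loop i) \<in> H" using assms by (rule val_gen_loop_in)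
  show ?thesis
    using assms
  proof (cases rule: indices_cases)
    case (\<sigma>_fixed x)
    then show ?thesis
      by (simp add: numeral_2_eq_2 val_loop conj_mult_conj ss)
  next
    case (\<tau>_fixed x)
    moreover have "u \<otimes> u \<otimes> u = \<one>" using uuu by (simp add: m_assoc)
    ultimately show ?thesis
      by (simp add: numeral_3_eq_3 val_loop conj_mult_conj)
  qed simp
qed

text \<open>
  The map \<open>\<psi>\<close> from \<open>F\<close> to the subgroup is the inverse of \<open>cocycle_hom\<close>. The essential point is that
  \<open>\<psi>\<close> sends the label of every step, and not just of those that define a factor, to its Schreier
  generator. For steps with trivial label this says that the Schreier generator is trivial, which is
  the compatibility of the chosen paths with the tree.
\<close>

theorem subgroup_iso_free_product: "H_group \<cong> F"
proof -
  obtain \<psi> where \<psi>: "\<psi> \<in> hom F H_group"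
    and \<psi>_gen: "\<And>i. i \<in> indices \<Longrightarrow> \<psi> (gen i) = val (gen_loop i)"
    using hom_from_F[OF H.is_group, of "\<lambda>i. val (gen_loop i)"] val_gen_loop_in val_gen_loop_pow
    by auto
  interpret \<psi>: group_hom F H_group \<psi>
    using \<psi> by unfold_locales
  interpret \<phi>: group_hom H_group F cocycle_hom
    using cocycle_hom by unfold_locales
  have left: "cocycle_hom (\<psi> f) = f" if "f \<in> carrier F" for f
  proof -
    have "(cocycle_hom \<circ> \<psi>) f = id f"
    proof (rule hom_eq_on_gen[OF F.is_group, where g = "cocycle_hom \<circ> \<psi>" and g' = id and f = f])
      show "cocycle_hom \<circ> \<psi> \<in> hom F F" using \<psi> cocycle_hom by (rule Group.hom_compose)
    qed (use that in \<open>auto simp: hom_def \<psi>_gen cocycle_hom_val cocycle_gen_loop\<close>)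
    then show ?thesis by simp
  qed
  have \<psi>_weight: "\<psi> (weight l x) = val (loop l x)" if x: "x \<in> cosets" for l x
  proof (cases l)
    case S
    have gen_S: "\<psi> (gen (2 * code y)) = val (loop S y)" if "y \<in> cosets" "2 * code y \<in> indices" for y
      using \<psi>_gen[OF that(2)] that(1) by (simp add: gen_loop_def)
    show ?thesis
    proof (rule weight_S_cases[OF x], goal_cases fixed tree forward backward)
      case tree
      have "rep (s <# x) = s \<otimes> rep x"
        using val_word_eq[OF path_tree_edge[OF x tree(2)]] by simp
      then show ?thesis using S tree by (simp add: val_loop m_assoc)
    next
      case backward
      have "inv val (loop S (s <# x)) = inv (inv rep x \<otimes> s \<otimes> rep (s <# x))"
        using \<sigma>\<sigma>[OF x] by (simp add: val_loop)
      also have "\<dots> = val (loop S x)"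
        using inv_equality[OF ss] by (simp add: val_loop inv_mult_group m_assoc)
      finally have "inv val (loop S (s <# x)) = val (loop S x)" .
      moreover have "val (loop S (s <# x)) \<in> H"
        using x by (intro val_loop_in \<sigma>_closed)
      ultimately show ?thesis using S backward x gen_S[of "s <# x"]
        by (simp add: m_inv_consistent[OF subgroup] del: weight.simps)
    qed (use S x gen_S in \<open>simp_all del: weight.simps\<close>)
  next
    case U
    show ?thesis
    proof (cases "u <# x = x")
      case True
      then show ?thesis using U x \<psi>_gen[of "Suc (2 * code x)"] by (simp add: gen_loop_def \<tau>_index)
    next
      case False
      have "rep (u <# x) = u \<otimes> rep x"
        using val_word_eq[OF path_\<tau>[OF x False]] by simp
      then show ?thesis using U False by (simp add: val_loop m_assoc)
    qed
  qed
  \<comment> \<open>The Schreier generators of the steps of a word telescope.\<close>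
  have \<psi>_cocycle: "\<psi> (cocycle w x) = inv rep (act w x) \<otimes> val w \<otimes> rep x" if x: "x \<in> cosets" for w x
  proof (induction w)
    case (Cons l w)
    have "act (l # w) x = act [l] (act w x)" using word_act_append[of _ _ "[l]" w x] by simp
    moreover have "val (l # w) = val [l] \<otimes> val w" using val_append[of "[l]" w] by simp
    ultimately show ?case
      using x Cons
      by (simp add: cocycle_Cons \<psi>_weight val_loop m_assoc mult_inv_cancel del: weight.simps val_simps word_act.simps)
  qed simp
  have right: "\<psi> (cocycle_hom h) = h" if "h \<in> H" for h
    using that by (rule H_eq_val) (simp add: cocycle_hom_val \<psi>_cocycle path_base)
  have "bij_betw cocycle_hom H (carrier F)"
    by (rule bij_betw_byWitness[where f' = \<psi>]) (use left right \<phi>.hom_closed \<psi>.hom_closed in auto)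
  then have "cocycle_hom \<in> iso H_group F"
    using cocycle_hom by (simp add: iso_def)
  then show ?thesis by (auto simp: is_iso_def)
qed

end

theorem corollary3p6p2:
  assumes "subgroup H PSL2Z"
  shows "\<exists>(I :: nat set) (G :: nat \<Rightarrow> int monoid).
           (\<forall>i\<in>I. G i \<in> {integer_group, integer_mod_group 2, integer_mod_group 3}) \<and>
           PSL2Z\<lparr>carrier := H\<rparr> \<cong> free_product I G"
proof -
  interpret modular_subgroup PSL2Z "pm matS" "pm matU" H
    using modular_presentation_PSL2Z assms
    by (simp add: modular_subgroup_def modular_subgroup_axioms_def)
  show ?thesis
    using factor_in subgroup_iso_free_product by blast
qed

end
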